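(* Let $\mathbf{U}=\bigvee_{p\in\mathbb{P}}\mathbf{Ab}(p)*\mathbf{Ab}(p-1)$. Let $F$ be a free group of infinite rank and let $H$ be a finitely generated subgroup of $F$. Then $H$ is neither $\mathbf{U}$-closed nor $\mathbf{U}$-dense, i.e. neither closed nor dense in the pro-$\mathbf{U}$ topology on $F$.
   Context: A pseudovariety is a class of finite groups closed under taking subgroups, homomorphic images and finitary direct products; $\bigvee$ denotes join (smallest pseudovariety containing all the given ones). $\mathbb{P}$ is the set of all primes. $\mathbf{Ab}(n)$ is the pseudovariety of finite abelian groups of exponent dividing $n$. For pseudovarieties $\mathbf{V},\mathbf{W}$, $\mathbf{V}*\mathbf{W}$ is the pseudovariety of all finite groups $G$ having a normal subgroup $N\in\mathbf{V}$ with $G/N\in\mathbf{W}$. For a pseudovariety $\mathbf{V}$, the pro-$\mathbf{V}$ topology on a group $G$ is the coarsest topology making all homomorphisms from $G$ to (discrete) groups in $\mathbf{V}$ continuous; equivalently, $G$ is a topological group in which the normal subgroups $K$ with $G/K\in\mathbf{V}$ form a basis of neighbourhoods of the identity. *)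

theory Defs
  imports "HOL-Analysis.Analysis" "HOL-Computational_Algebra.Primes" "HOL-Algebra.Product_Groups"
begin

subsection \<open>Classes of finite groups\<close>

text \<open>HOL cannot quantify over classes of groups with arbitrary carrier types. Every finite group
  is isomorphic to one with carrier in \<^typ>\<open>nat\<close>, so an isomorphism-closed class of finite groups
  is represented by the set of its members of type \<^typ>\<open>nat monoid\<close>; a group of any other type
  belongs to the class if it is isomorphic to such a member.\<close>

type_synonym group_class = "nat monoid set"

definition finite_groups :: group_class
  where "finite_groups = {G. group G \<and> finite (carrier G)}"

definition belongs_to :: "('a, 'b) monoid_scheme \<Rightarrow> group_class \<Rightarrow> bool"
  where "belongs_to G V \<longleftrightarrow> group G \<and> (\<exists>K\<in>V. G \<cong> K)"

text \<open>Closure under homomorphic images includes closure under isomorphism. The products are over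
  finite index sets, the empty one included, so a pseudovariety contains the trivial groups.\<close>

definition pseudovariety :: "group_class \<Rightarrow> bool"
  where "pseudovariety V \<longleftrightarrow>
    V \<subseteq> finite_groups \<and>
    (\<forall>G\<in>V. \<forall>S. subgroup S G \<longrightarrow> G\<lparr>carrier := S\<rparr> \<in> V) \<and>
    (\<forall>G\<in>V. \<forall>K :: nat monoid. \<forall>h.
       group K \<and> h \<in> hom G K \<and> h ` carrier G = carrier K \<longrightarrow> K \<in> V) \<and>
    (\<forall>(I :: nat set) (G :: nat \<Rightarrow> nat monoid) (K :: nat monoid).
       finite I \<and> (\<forall>i\<in>I. G i \<in> V) \<and> group K \<and> product_group I G \<cong> K \<longrightarrow> K \<in> V)"

definition pv_join :: "group_class set \<Rightarrow> group_class"
  where "pv_join \<V> = \<Inter> {W. pseudovariety W \<and> \<Union>\<V> \<subseteq> W}"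

definition Ab :: "nat \<Rightarrow> group_class"
  where "Ab n = {G. comm_group G \<and> finite (carrier G) \<and>
                    (\<forall>x\<in>carrier G. x [^]\<^bsub>G\<^esub> n = \<one>\<^bsub>G\<^esub>)}"

definition pv_prod :: "group_class \<Rightarrow> group_class \<Rightarrow> group_class"
  where "pv_prod V W = {G. group G \<and> finite (carrier G) \<and>
           (\<exists>N. N \<lhd> G \<and> G\<lparr>carrier := N\<rparr> \<in> V \<and> belongs_to (G Mod N) W)}"

definition U :: group_class
  where "U = pv_join {pv_prod (Ab p) (Ab (p - 1)) | p. prime p}"

lemma pseudovariety_finite_groups: "pseudovariety finite_groups"
  unfolding pseudovariety_def
proof (intro conjI ballI allI impI)
  fix G :: "nat monoid" and S assume "G \<in> finite_groups" "subgroup S G"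
  then show "G\<lparr>carrier := S\<rparr> \<in> finite_groups"
    by (simp add: finite_groups_def group.subgroup_imp_group)
       (metis finite_subset subgroup.subset)
next
  fix G K :: "nat monoid" and h
  assume "G \<in> finite_groups" "group K \<and> h \<in> hom G K \<and> h ` carrier G = carrier K"
  then show "K \<in> finite_groups"
    unfolding finite_groups_def by (metis finite_imageI mem_Collect_eq)
next
  fix I :: "nat set" and G :: "nat \<Rightarrow> nat monoid" and K :: "nat monoid"
  assume *: "finite I \<and> (\<forall>i\<in>I. G i \<in> finite_groups) \<and> group K \<and> product_group I G \<cong> K"
  then have "finite (carrier (product_group I G))"
    by (auto simp: finite_groups_def intro!: finite_PiE)
  moreover obtain h where "bij_betw h (carrier (product_group I G)) (carrier K)"
    using * by (auto simp: is_iso_def iso_def)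
  ultimately have "finite (carrier K)"
    using bij_betw_finite by blast
  then show "K \<in> finite_groups"
    using * by (simp add: finite_groups_def)
qed simp

lemma pseudovariety_pv_join:
  assumes "\<Union>\<V> \<subseteq> finite_groups"
  shows "pseudovariety (pv_join \<V>)"
  unfolding pseudovariety_def
proof (intro conjI ballI allI impI)
  show "pv_join \<V> \<subseteq> finite_groups"
    unfolding pv_join_def using assms pseudovariety_finite_groups
    by (intro Inter_lower) simp
next
  fix G :: "nat monoid" and S assume *: "G \<in> pv_join \<V>" "subgroup S G"
  show "G\<lparr>carrier := S\<rparr> \<in> pv_join \<V>"
    unfolding pv_join_def
  proof (rule InterI)
    fix W assume W: "W \<in> {W. pseudovariety W \<and> \<Union>\<V> \<subseteq> W}"
    with * have "G \<in> W" by (simp add: pv_join_def)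
    moreover have "\<forall>G\<in>W. \<forall>S. subgroup S G \<longrightarrow> G\<lparr>carrier := S\<rparr> \<in> W"
      using W unfolding pseudovariety_def mem_Collect_eq by (elim conjE)
    ultimately show "G\<lparr>carrier := S\<rparr> \<in> W" using *(2) by blast
  qed
next
  fix G K :: "nat monoid" and h
  assume *: "G \<in> pv_join \<V>" "group K \<and> h \<in> hom G K \<and> h ` carrier G = carrier K"
  show "K \<in> pv_join \<V>"
    unfolding pv_join_def
  proof (rule InterI)
    fix W assume W: "W \<in> {W. pseudovariety W \<and> \<Union>\<V> \<subseteq> W}"
    with * have "G \<in> W" by (simp add: pv_join_def)
    moreover have "\<forall>G\<in>W. \<forall>K :: nat monoid. \<forall>h.
       group K \<and> h \<in> hom G K \<and> h ` carrier G = carrier K \<longrightarrow> K \<in> W"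
      using W unfolding pseudovariety_def mem_Collect_eq by (elim conjE)
    ultimately show "K \<in> W" using *(2) by blast
  qed
next
  fix I :: "nat set" and G :: "nat \<Rightarrow> nat monoid" and K :: "nat monoid"
  assume *: "finite I \<and> (\<forall>i\<in>I. G i \<in> pv_join \<V>) \<and> group K \<and> product_group I G \<cong> K"
  show "K \<in> pv_join \<V>"
    unfolding pv_join_def
  proof (rule InterI)
    fix W assume W: "W \<in> {W. pseudovariety W \<and> \<Union>\<V> \<subseteq> W}"
    with * have "\<forall>i\<in>I. G i \<in> W" by (simp add: pv_join_def)
    moreover have "\<forall>(I :: nat set) (G :: nat \<Rightarrow> nat monoid) (K :: nat monoid).
       finite I \<and> (\<forall>i\<in>I. G i \<in> W) \<and> group K \<and> product_group I G \<cong> K \<longrightarrow> K \<in> W"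
      using W unfolding pseudovariety_def mem_Collect_eq by (elim conjE)
    ultimately show "K \<in> W" using * by blast
  qed
qed

subsection \<open>The pro-V topology\<close>

text \<open>The coarsest topology on the carrier for which all homomorphisms to members of the class,
  taken with the discrete topology, are continuous.\<close>

definition pro_topology :: "group_class \<Rightarrow> ('a, 'b) monoid_scheme \<Rightarrow> 'a topology"
  where "pro_topology V G = topology_generated_by
           {h -` A \<inter> carrier G | h A K. K \<in> V \<and> h \<in> hom G K \<and> A \<subseteq> carrier K}"

lemma topspace_pro_topology:
  assumes "pseudovariety V" "group G"
  shows "topspace (pro_topology V G) = carrier G"
proof -
  define T :: "nat monoid" where "T = singleton_group 0"
  have "group T" by (simp add: T_def)
  have "product_group {} (\<lambda>_ :: nat. T) \<cong> T"
  proof (rule is_isoI)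
    show "(\<lambda>_. 0) \<in> iso (product_group {} (\<lambda>_ :: nat. T)) T"
      by (auto simp: iso_def hom_def bij_betw_def T_def singleton_group_def)
  qed
  moreover have "\<forall>(I :: nat set) (G :: nat \<Rightarrow> nat monoid) (K :: nat monoid).
       finite I \<and> (\<forall>i\<in>I. G i \<in> V) \<and> group K \<and> product_group I G \<cong> K \<longrightarrow> K \<in> V"
    using assms(1) unfolding pseudovariety_def by (elim conjE)
  ultimately have "T \<in> V"
    using \<open>group T\<close> by (metis empty_iff finite.emptyI)
  moreover have "(\<lambda>_. 0) \<in> hom G T"
    by (auto simp: hom_def T_def singleton_group_def)
  moreover have "(\<lambda>_. 0) -` carrier T \<inter> carrier G = carrier G"
    by (auto simp: T_def singleton_group_def)
  ultimately have "carrier G \<in>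
      {h -` A \<inter> carrier G | h A K. K \<in> V \<and> h \<in> hom G K \<and> A \<subseteq> carrier K}"
    by (intro CollectI exI[of _ "\<lambda>_. 0"] exI[of _ "carrier T"] exI[of _ T]) simp
  then show ?thesis
    unfolding pro_topology_def topology_generated_by_topspace
    by (intro equalityI Union_upper Union_least) auto
qed

subsection \<open>Free groups\<close>

text \<open>The letter \<open>(True, x)\<close> stands for \<open>x\<close> and \<open>(False, x)\<close> for its inverse.\<close>

definition eval_letter :: "('a, 'b) monoid_scheme \<Rightarrow> bool \<times> 'a \<Rightarrow> 'a"
  where "eval_letter G l = (if fst l then snd l else inv\<^bsub>G\<^esub> (snd l))"

definition eval_word :: "('a, 'b) monoid_scheme \<Rightarrow> (bool \<times> 'a) list \<Rightarrow> 'a"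
  where "eval_word G w = foldr (\<lambda>l g. eval_letter G l \<otimes>\<^bsub>G\<^esub> g) w \<one>\<^bsub>G\<^esub>"

definition reduced_words :: "'a set \<Rightarrow> (bool \<times> 'a) list set"
  where "reduced_words X = {w. set w \<subseteq> UNIV \<times> X \<and>
           successively (\<lambda>l m. \<not> (snd l = snd m \<and> fst l \<noteq> fst m)) w}"

text \<open>A group is free on \<open>X\<close> if each of its elements is expressed by exactly one reduced word
  over \<open>X\<close>.\<close>

definition free_basis :: "('a, 'b) monoid_scheme \<Rightarrow> 'a set \<Rightarrow> bool"
  where "free_basis G X \<longleftrightarrow>
    X \<subseteq> carrier G \<and> bij_betw (eval_word G) (reduced_words X) (carrier G)"

definition free_group_of_infinite_rank :: "('a, 'b) monoid_scheme \<Rightarrow> bool"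
  where "free_group_of_infinite_rank G \<longleftrightarrow> group G \<and> (\<exists>X. infinite X \<and> free_basis G X)"

definition fg_subgroup :: "'a set \<Rightarrow> ('a, 'b) monoid_scheme \<Rightarrow> bool"
  where "fg_subgroup H G \<longleftrightarrow>
    subgroup H G \<and> (\<exists>S. finite S \<and> S \<subseteq> carrier G \<and> H = generate G S)"

end

theory Submission
  imports Defs
begin

text \<open>A finitely generated subgroup \<open>H\<close> of \<open>F\<close> involves only finitely many letters of an infinite
  basis \<open>X\<close>, so some letter \<open>a \<in> X\<close> occurs in the normal form of no element of \<open>H\<close>
  (\<open>fg_subgroup_finite_support\<close>). Both assertions are read off from this letter.

  Not closed: each group in \<open>Ab(p) * Ab(p - 1)\<close> is abelian-by-abelian, hence satisfies the law
  \<open>[[x,y],[z,t]] = 1\<close>. Laws are inherited by subgroups, images and products, so the law holds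
  throughout \<open>U\<close> (\<open>U_metabelian\<close>). Choose further letters \<open>b, c, d\<close> of \<open>X\<close> such that
  \<open>a, b, c, d\<close> are distinct. Every homomorphism from \<open>F\<close> to a group in \<open>U\<close> sends
  \<open>[[a,b],[c,d]]\<close> to \<open>1\<close>, so no open set separates this element from \<open>1 \<in> H\<close>. But
  written out in letters it is a reduced word containing \<open>a\<close>, so it is not in \<open>H\<close>.

  Not dense: the class \<open>U\<close> contains the group of order 2 (take \<open>p = 2\<close>). The parity of the number
  of occurrences of \<open>a\<close> is a homomorphism from \<open>F\<close> to this group (\<open>letter_parity_hom\<close>); it
  vanishes on \<open>H\<close> but not at \<open>a\<close>, so the set where it is odd is a nonempty open set that misses
  \<open>H\<close>.\<close>

section \<open>Normal forms in a free group\<close>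

lemma (in group) eval_letter_closed:
  "snd l \<in> carrier G \<Longrightarrow> eval_letter G l \<in> carrier G"
  by (simp add: eval_letter_def)

lemma eval_word_Nil [simp]: "eval_word G [] = \<one>\<^bsub>G\<^esub>"
  by (simp add: eval_word_def)

lemma eval_word_Cons [simp]:
  "eval_word G (l # w) = eval_letter G l \<otimes>\<^bsub>G\<^esub> eval_word G w"
  by (simp add: eval_word_def)

lemma (in group) eval_word_closed:
  "set w \<subseteq> UNIV \<times> carrier G \<Longrightarrow> eval_word G w \<in> carrier G"
  by (induction w) (auto simp: eval_letter_closed)

lemma (in group) eval_word_append:
  assumes "set v \<subseteq> UNIV \<times> carrier G" "set w \<subseteq> UNIV \<times> carrier G"
  shows "eval_word G (v @ w) = eval_word G v \<otimes> eval_word G w"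
  using assms by (induction v) (auto simp: eval_letter_closed eval_word_closed m_assoc)

definition inverse_letter :: "bool \<times> 'a \<Rightarrow> bool \<times> 'a"
  where "inverse_letter l = (\<not> fst l, snd l)"

lemma (in group) eval_inverse_letter:
  "snd l \<in> carrier G \<Longrightarrow> eval_letter G (inverse_letter l) = inv (eval_letter G l)"
  by (simp add: eval_letter_def inverse_letter_def)

lemma (in group) eval_inverse_word:
  assumes "set w \<subseteq> UNIV \<times> carrier G"
  shows "eval_word G (map inverse_letter (rev w)) = inv (eval_word G w)"
  using assms
proof (induction w)
  case (Cons l w)
  have "set (map inverse_letter (rev w)) \<subseteq> UNIV \<times> carrier G"
    using Cons.prems by (auto simp: inverse_letter_def)
  moreover have l: "snd l \<in> carrier G"
    using Cons.prems by auto
  moreover have "inverse_letter l \<in> UNIV \<times> carrier G"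
    using l by (auto simp: inverse_letter_def)
  ultimately show ?case
    using Cons by (simp add: eval_word_append eval_inverse_letter eval_letter_closed
        eval_word_closed inv_mult_group)
qed simp

lemma in_reduced_wordsD: "w \<in> reduced_words X \<Longrightarrow> set w \<subseteq> UNIV \<times> X"
  by (simp add: reduced_words_def)

text \<open>Free cancellation deletes a letter together with an adjacent inverse. Hence it brings in no new
  letters and preserves the parity of the number of occurrences of each generator.\<close>

lemma (in group) word_reduction:
  assumes "X \<subseteq> carrier G" "set w \<subseteq> UNIV \<times> X"
  shows "\<exists>v\<in>reduced_words X. set v \<subseteq> set w \<and> eval_word G v = eval_word G w \<and>
           (\<forall>x. even (count_list (map snd v) x) \<longleftrightarrow> even (count_list (map snd w) x))"
  using assms(2)
proof (induction w)
  case Nil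
  then show ?case by (auto simp: reduced_words_def)
next
  case (Cons l w)
  from Cons obtain v where v: "v \<in> reduced_words X" "set v \<subseteq> set w"
      "eval_word G v = eval_word G w"
      "\<And>x. even (count_list (map snd v) x) \<longleftrightarrow> even (count_list (map snd w) x)"
    by auto
  have l: "snd l \<in> X" "l \<in> UNIV \<times> X" using Cons.prems by auto
  show ?case
  proof (cases "v \<noteq> [] \<and> hd v = inverse_letter l")
    case True
    then obtain u where u: "v = inverse_letter l # u" by (cases v) auto
    have red: "u \<in> reduced_words X"
      using v(1) by (cases u) (auto simp: u reduced_words_def)
    have carr: "eval_letter G l \<in> carrier G" "eval_word G u \<in> carrier G"
      using l assms(1) in_reduced_wordsD[OF red]
      by (auto intro!: eval_letter_closed eval_word_closed)
    have "eval_word G (l # w) = eval_letter G l \<otimes> (inv (eval_letter G l) \<otimes> eval_word G u)"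
      using v(3) l assms(1) by (auto simp: u eval_inverse_letter subset_iff)
    also have "\<dots> = eval_word G u"
      using carr by (simp flip: m_assoc)
    finally have ev: "eval_word G u = eval_word G (l # w)" by simp
    have par: "even (count_list (map snd u) x) \<longleftrightarrow> even (count_list (map snd (l # w)) x)" for x
      using v(4)[of x] by (auto simp: u inverse_letter_def)
    show ?thesis using red ev par v(2) by (intro bexI[of _ u]) (auto simp: u)
  next
    case False
    then have "l # v \<in> reduced_words X"
      using v(1) l by (cases v) (auto simp: reduced_words_def inverse_letter_def prod_eq_iff)
    then show ?thesis using v by (intro bexI[of _ "l # v"]) auto
  qed
qed

text \<open>The unique reduced word for \<open>g\<close>; meaningful when \<open>X\<close> is a free basis of \<open>G\<close>.\<close>

definition normal_form :: "('a, 'b) monoid_scheme \<Rightarrow> 'a set \<Rightarrow> 'a \<Rightarrow> (bool \<times> 'a) list"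
  where "normal_form G X g = inv_into (reduced_words X) (eval_word G) g"

lemma normal_form_eval:
  "free_basis G X \<Longrightarrow> w \<in> reduced_words X \<Longrightarrow> normal_form G X (eval_word G w) = w"
  by (simp add: free_basis_def normal_form_def bij_betw_def)

lemma
  assumes "free_basis G X" "g \<in> carrier G"
  shows eval_normal_form: "eval_word G (normal_form G X g) = g"
    and normal_form_reduced: "normal_form G X g \<in> reduced_words X"
  using assms
  by (auto simp: free_basis_def normal_form_def bij_betw_def f_inv_into_f intro!: inv_into_into)

lemma
  assumes "group G" "free_basis G X" "set w \<subseteq> UNIV \<times> X"
  shows set_normal_form_eval: "set (normal_form G X (eval_word G w)) \<subseteq> set w"
    and parity_normal_form_eval:
      "even (count_list (map snd (normal_form G X (eval_word G w))) x) \<longleftrightarrow>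
       even (count_list (map snd w) x)"
proof -
  have "X \<subseteq> carrier G" using assms(2) by (simp add: free_basis_def)
  then obtain v where v: "v \<in> reduced_words X" "set v \<subseteq> set w" "eval_word G v = eval_word G w"
      "\<And>x. even (count_list (map snd v) x) \<longleftrightarrow> even (count_list (map snd w) x)"
    using group.word_reduction[OF assms(1) _ assms(3)] by metis
  have "normal_form G X (eval_word G w) = v"
    using normal_form_eval[OF assms(2) v(1)] v(3) by simp
  with v show "set (normal_form G X (eval_word G w)) \<subseteq> set w"
    and "even (count_list (map snd (normal_form G X (eval_word G w))) x) \<longleftrightarrow>
         even (count_list (map snd w) x)"
    by simp_all
qed

text \<open>The support consists of the letters in the normal forms of the generators: products and
  inverses of words in these letters are again such words, and passing to a normal form brings in
  no new ones.\<close>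

lemma fg_subgroup_finite_support:
  fixes G (structure)
  assumes G: "group G" and X: "free_basis G X" and H: "fg_subgroup H G"
  shows "\<exists>Y\<subseteq>X. finite Y \<and> (\<forall>g\<in>H. set (normal_form G X g) \<subseteq> UNIV \<times> Y)"
proof -
  interpret group G by fact
  obtain S where S: "finite S" "S \<subseteq> carrier G" "H = generate G S"
    using H by (auto simp: fg_subgroup_def)
  have XG: "X \<subseteq> carrier G" using X by (simp add: free_basis_def)
  define Y where "Y = (\<Union>s\<in>S. snd ` set (normal_form G X s))"
  have YX: "Y \<subseteq> X"
    using S(2) in_reduced_wordsD[OF normal_form_reduced[OF X]]
    unfolding Y_def by (intro UN_least) (auto simp: subset_iff)
  then have YG: "UNIV \<times> Y \<subseteq> UNIV \<times> carrier G" using XG by auto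
  have S_word: "set (normal_form G X s) \<subseteq> UNIV \<times> Y" if "s \<in> S" for s
    using that unfolding Y_def subset_iff mem_Times_iff by blast
  have word: "\<exists>w. set w \<subseteq> UNIV \<times> Y \<and> g = eval_word G w" if "g \<in> generate G S" for g
    using that
  proof (induction rule: generate.induct)
    case one
    then show ?case by (intro exI[of _ "[]"]) auto
  next
    case (incl s)
    then show ?case
      using S(2) S_word eval_normal_form[OF X] by (intro exI[of _ "normal_form G X s"]) auto
  next
    case (inv s)
    have "inv s = eval_word G (map inverse_letter (rev (normal_form G X s)))"
      using inv S(2) S_word[OF inv] YG eval_normal_form[OF X, of s]
      by (subst eval_inverse_word) auto
    moreover have "set (map inverse_letter (rev (normal_form G X s))) \<subseteq> UNIV \<times> Y"
      using S_word[OF inv] by (auto simp: inverse_letter_def)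
    ultimately show ?case by blast
  next
    case (eng g h)
    then obtain v w where "set v \<subseteq> UNIV \<times> Y" "g = eval_word G v"
        "set w \<subseteq> UNIV \<times> Y" "h = eval_word G w"
      by auto
    then show ?case
      using eval_word_append[of v w] YG by (intro exI[of _ "v @ w"]) (simp add: subset_trans[OF _ YG])
  qed
  have "set (normal_form G X g) \<subseteq> UNIV \<times> Y" if g: "g \<in> H" for g
  proof -
    obtain w where w: "set w \<subseteq> UNIV \<times> Y" "g = eval_word G w"
      using word g S(3) by blast
    then have "set w \<subseteq> UNIV \<times> X" using YX by auto
    from set_normal_form_eval[OF G X this] w show ?thesis by blast
  qed
  moreover have "finite Y" using S(1) by (simp add: Y_def)
  ultimately show ?thesis using YX by blast
qed

definition parity_group :: "nat monoid"
  where "parity_group = \<lparr>carrier = {0, 1}, mult = (\<lambda>a b. (a + b) mod 2), one = 0\<rparr>"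

lemma comm_group_parity_group: "comm_group parity_group"
  by (rule comm_groupI) (auto simp: parity_group_def)

text \<open>Concatenating normal forms adds the numbers of occurrences, and the cancellation that follows
  keeps their parity.\<close>

lemma letter_parity_hom:
  fixes G (structure)
  assumes G: "group G" and X: "free_basis G X"
  shows "(\<lambda>g. count_list (map snd (normal_form G X g)) x mod 2) \<in> hom G parity_group"
proof (rule homI)
  interpret group G by fact
  fix g h assume gh: "g \<in> carrier G" "h \<in> carrier G"
  let ?v = "normal_form G X g" and ?w = "normal_form G X h"
  have words: "set ?v \<subseteq> UNIV \<times> X" "set ?w \<subseteq> UNIV \<times> X"
    using gh in_reduced_wordsD[OF normal_form_reduced[OF X]] by auto
  moreover have "X \<subseteq> carrier G" using X by (simp add: free_basis_def)
  ultimately have "eval_word G (?v @ ?w) = eval_word G ?v \<otimes> eval_word G ?w"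
    by (intro eval_word_append) auto
  then have "eval_word G (?v @ ?w) = g \<otimes> h"
    using gh eval_normal_form[OF X] by simp
  then have "even (count_list (map snd (normal_form G X (g \<otimes> h))) x) \<longleftrightarrow>
      even (count_list (map snd ?v) x + count_list (map snd ?w) x)"
    using parity_normal_form_eval[OF G X, of "?v @ ?w" x] words by simp
  then have "count_list (map snd (normal_form G X (g \<otimes> h))) x mod 2 =
      (count_list (map snd ?v) x + count_list (map snd ?w) x) mod 2"
    unfolding mod2_eq_if by simp
  then show "count_list (map snd (normal_form G X (g \<otimes> h))) x mod 2 =
      (count_list (map snd ?v) x mod 2) \<otimes>\<^bsub>parity_group\<^esub> (count_list (map snd ?w) x mod 2)"
    by (simp add: parity_group_def mod_simps)
qed (auto simp: parity_group_def)

section \<open>The metabelian law\<close>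

definition commutator :: "('a, 'b) monoid_scheme \<Rightarrow> 'a \<Rightarrow> 'a \<Rightarrow> 'a"
  where "commutator G a b = a \<otimes>\<^bsub>G\<^esub> b \<otimes>\<^bsub>G\<^esub> inv\<^bsub>G\<^esub> a \<otimes>\<^bsub>G\<^esub> inv\<^bsub>G\<^esub> b"

lemma (in group) commutator_closed:
  "a \<in> carrier G \<Longrightarrow> b \<in> carrier G \<Longrightarrow> commutator G a b \<in> carrier G"
  by (simp add: commutator_def)

lemma hom_commutator:
  assumes "group G" "group K" "h \<in> hom G K" "a \<in> carrier G" "b \<in> carrier G"
  shows "h (commutator G a b) = commutator K (h a) (h b)"
proof -
  interpret group_hom G K h
    using assms(1-3) by (simp add: group_hom_def group_hom_axioms_def)
  show ?thesis using assms(4,5) by (simp add: commutator_def)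
qed

lemma (in comm_group) commutator_eq_one:
  assumes "a \<in> carrier G" "b \<in> carrier G"
  shows "commutator G a b = \<one>"
proof -
  have "commutator G a b = a \<otimes> b \<otimes> inv (a \<otimes> b)"
    using assms by (simp add: commutator_def inv_mult m_assoc)
  then show ?thesis using assms by simp
qed

text \<open>Metabelian groups are encoded by the law that defines them as a variety, because the closure
  properties below are immediate for a law.\<close>

definition metabelian :: "('a, 'b) monoid_scheme \<Rightarrow> bool"
  where "metabelian G \<longleftrightarrow> group G \<and>
    (\<forall>a\<in>carrier G. \<forall>b\<in>carrier G. \<forall>c\<in>carrier G. \<forall>d\<in>carrier G.
       commutator G (commutator G a b) (commutator G c d) = \<one>\<^bsub>G\<^esub>)"

lemma metabelian_imp_group: "metabelian G \<Longrightarrow> group G"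
  by (simp add: metabelian_def)

text \<open>A value of a commutator expression that is not \<open>1\<close> would keep a nontrivial image under one of
  the separating homomorphisms. Both subgroups (separated by the inclusion) and products (separated
  by the projections) are covered.\<close>

lemma metabelian_if_separated:
  fixes G :: "('a, 'b) monoid_scheme" (structure)
  assumes G: "group G"
    and sep: "\<And>x. x \<in> carrier G \<Longrightarrow> x \<noteq> \<one>\<^bsub>G\<^esub> \<Longrightarrow>
      \<exists>(K :: ('c, 'd) monoid_scheme) h. metabelian K \<and> h \<in> hom G K \<and> h x \<noteq> \<one>\<^bsub>K\<^esub>"
  shows "metabelian G"
  unfolding metabelian_def
proof (intro conjI ballI, fact)
  interpret group G by fact
  fix a b c d assume *: "a \<in> carrier G" "b \<in> carrier G" "c \<in> carrier G" "d \<in> carrier G"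
  let ?x = "commutator G (commutator G a b) (commutator G c d)"
  show "?x = \<one>"
  proof (rule ccontr)
    assume "?x \<noteq> \<one>"
    then obtain K :: "('c, 'd) monoid_scheme" and h where
      K: "metabelian K" "h \<in> hom G K" "h ?x \<noteq> \<one>\<^bsub>K\<^esub>"
      using sep * by (metis commutator_closed)
    have "h a \<in> carrier K" "h b \<in> carrier K" "h c \<in> carrier K" "h d \<in> carrier K"
      using K(2) * by (auto simp: hom_def)
    then have "h ?x = \<one>\<^bsub>K\<^esub>"
      using K(1) * by (simp add: metabelian_def commutator_closed
          hom_commutator[OF G metabelian_imp_group[OF K(1)] K(2)])
    with K(3) show False by simp
  qed
qed

lemma metabelian_image:
  assumes G: "metabelian G" and K: "group K" and h: "h \<in> hom G K" "h ` carrier G = carrier K"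
  shows "metabelian K"
  unfolding metabelian_def h(2)[symmetric]
proof (intro conjI ballI; (elim imageE)?)
  show "group K" by fact
  interpret group_hom G K h
    using assms by (simp add: metabelian_def group_hom_def group_hom_axioms_def)
  fix x y z t a b c d
  assume *: "x = h a" "y = h b" "z = h c" "t = h d"
    "a \<in> carrier G" "b \<in> carrier G" "c \<in> carrier G" "d \<in> carrier G"
  have "h (commutator G (commutator G a b) (commutator G c d)) =
      commutator K (commutator K (h a) (h b)) (commutator K (h c) (h d))"
    using * G.commutator_closed by (simp add: hom_commutator[OF G.group_axioms K h(1)])
  then show "commutator K (commutator K x y) (commutator K z t) = \<one>\<^bsub>K\<^esub>"
    using * G by (simp add: metabelian_def)
qed

lemma metabelian_subgroup:
  assumes G: "metabelian G" and S: "subgroup S G"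
  shows "metabelian (G\<lparr>carrier := S\<rparr>)"
proof (rule metabelian_if_separated)
  show "group (G\<lparr>carrier := S\<rparr>)"
    using assms by (simp add: metabelian_def group.subgroup_imp_group)
  show "\<exists>(K :: ('a, 'b) monoid_scheme) h.
      metabelian K \<and> h \<in> hom (G\<lparr>carrier := S\<rparr>) K \<and> h x \<noteq> \<one>\<^bsub>K\<^esub>"
    if "x \<noteq> \<one>\<^bsub>G\<lparr>carrier := S\<rparr>\<^esub>" for x
    using that G subgroup.subset[OF S]
    by (intro exI[of _ G] exI[of _ "\<lambda>x. x"]) (auto simp: hom_def)
qed

lemma metabelian_product:
  fixes G :: "'i \<Rightarrow> ('b, 'c) monoid_scheme"
  assumes G: "\<And>i. i \<in> I \<Longrightarrow> metabelian (G i)"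
  shows "metabelian (product_group I G)"
proof (rule metabelian_if_separated)
  show "group (product_group I G)"
    using G by (simp add: metabelian_def)
  fix x assume x: "x \<in> carrier (product_group I G)" "x \<noteq> \<one>\<^bsub>product_group I G\<^esub>"
  then obtain i where i: "i \<in> I" "x i \<noteq> \<one>\<^bsub>G i\<^esub>"
    by (fastforce simp: PiE_iff extensional_def)
  moreover have "(\<lambda>f. f i) \<in> hom (product_group I G) (G i)"
    using i(1) by (auto simp: hom_def)
  ultimately show "\<exists>(K :: ('b, 'c) monoid_scheme) h.
      metabelian K \<and> h \<in> hom (product_group I G) K \<and> h x \<noteq> \<one>\<^bsub>K\<^esub>"
    using G by (intro exI[of _ "G i"] exI[of _ "\<lambda>f. f i"]) simp
qed

lemma pseudovariety_metabelian:
  "pseudovariety {G. metabelian G \<and> finite (carrier G)}"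
  unfolding pseudovariety_def
proof (intro conjI ballI allI impI)
  show "{G. metabelian G \<and> finite (carrier G)} \<subseteq> finite_groups"
    by (auto simp: metabelian_def finite_groups_def)
next
  fix G :: "nat monoid" and S
  assume "G \<in> {G. metabelian G \<and> finite (carrier G)}" "subgroup S G"
  then show "G\<lparr>carrier := S\<rparr> \<in> {G. metabelian G \<and> finite (carrier G)}"
    by (auto intro: metabelian_subgroup finite_subset dest: subgroup.subset)
next
  fix G K :: "nat monoid" and h
  assume "G \<in> {G. metabelian G \<and> finite (carrier G)}"
    "group K \<and> h \<in> hom G K \<and> h ` carrier G = carrier K"
  then show "K \<in> {G. metabelian G \<and> finite (carrier G)}"
    using metabelian_image[of G K h] finite_imageI[of "carrier G" h] by simp
next
  fix I :: "nat set" and G :: "nat \<Rightarrow> nat monoid" and K :: "nat monoid"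
  assume *: "finite I \<and> (\<forall>i\<in>I. G i \<in> {G. metabelian G \<and> finite (carrier G)}) \<and> group K \<and>
    product_group I G \<cong> K"
  then have "metabelian (product_group I G)" "finite (carrier (product_group I G))"
    by (auto intro!: metabelian_product finite_PiE)
  moreover obtain h where h: "h \<in> hom (product_group I G) K"
      "h ` carrier (product_group I G) = carrier K"
    using * by (auto simp: is_iso_def iso_def bij_betw_def)
  ultimately show "K \<in> {G. metabelian G \<and> finite (carrier G)}"
    using * metabelian_image[OF _ _ h] finite_imageI[of "carrier (product_group I G)" h] by simp
qed

text \<open>Commutators die in the abelian quotient, so they lie in the abelian kernel \<open>N\<close> and
  commute with each other.\<close>

lemma metabelian_pv_prod_Ab:
  fixes G (structure)
  assumes "G \<in> pv_prod (Ab m) (Ab n)"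
  shows "metabelian G"
proof -
  obtain N where G: "group G" and N: "N \<lhd> G" "comm_group (G\<lparr>carrier := N\<rparr>)"
      "belongs_to (G Mod N) (Ab n)"
    using assms by (auto simp: pv_prod_def Ab_def)
  interpret normal N G by fact
  obtain K :: "nat monoid" and \<phi> where K: "comm_group K" and \<phi>: "\<phi> \<in> iso (G Mod N) K"
    using N(3) by (auto simp: belongs_to_def is_iso_def Ab_def)
  have gK: "group K" using K by (simp add: comm_group.axioms)
  have comm_N: "commutator G a b \<in> N" if ab: "a \<in> carrier G" "b \<in> carrier G" for a b
  proof -
    have proj: "(\<lambda>a. N #> a) \<in> hom G (G Mod N)"
      by (rule r_coset_hom_Mod)
    have in_Mod: "N #> a \<in> carrier (G Mod N)" if "a \<in> carrier G" for a
      using proj that by (auto simp: hom_def)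
    have \<phi>_hom: "\<phi> \<in> hom (G Mod N) K" using \<phi> by (simp add: iso_def)
    have \<phi>_in: "\<phi> (N #> a) \<in> carrier K" if "a \<in> carrier G" for a
      using \<phi>_hom in_Mod[OF that] by (auto simp: hom_def)
    have \<phi>_inj: "inj_on \<phi> (carrier (G Mod N))"
      using \<phi> by (simp add: iso_def bij_betw_def)
    have "\<phi> (N #> commutator G a b) = \<phi> (commutator (G Mod N) (N #> a) (N #> b))"
      by (rule arg_cong[OF hom_commutator[OF G factorgroup_is_group proj ab]])
    also have "\<dots> = commutator K (\<phi> (N #> a)) (\<phi> (N #> b))"
      by (rule hom_commutator[OF factorgroup_is_group gK \<phi>_hom in_Mod[OF ab(1)] in_Mod[OF ab(2)]])
    also have "\<dots> = \<one>\<^bsub>K\<^esub>"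
      by (rule comm_group.commutator_eq_one[OF K \<phi>_in[OF ab(1)] \<phi>_in[OF ab(2)]])
    also have "\<dots> = \<phi> \<one>\<^bsub>G Mod N\<^esub>"
      by (rule hom_one[OF \<phi>_hom factorgroup_is_group gK, symmetric])
    finally have "N #> commutator G a b = \<one>\<^bsub>G Mod N\<^esub>"
      by (rule inj_onD[OF \<phi>_inj _ in_Mod[OF commutator_closed[OF ab]]
          monoid.one_closed[OF group.is_monoid[OF factorgroup_is_group]]])
    then have "N #> commutator G a b = N" by (simp add: FactGroup_def)
    moreover have "commutator G a b \<in> N #> commutator G a b"
      by (rule rcos_self[OF commutator_closed[OF ab] subgroup_axioms])
    ultimately show ?thesis by simp
  qed
  have N_comm: "x \<otimes> y = y \<otimes> x" if "x \<in> N" "y \<in> N" for x y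
    using comm_groupE(4)[OF N(2)] that by simp
  have "commutator G x y = \<one>" if xy: "x \<in> N" "y \<in> N" for x y
  proof -
    have "x \<in> carrier G" "y \<in> carrier G" using xy subset by auto
    moreover from this have "commutator G x y = (x \<otimes> y) \<otimes> inv (y \<otimes> x)"
      by (simp add: commutator_def inv_mult_group m_assoc)
    ultimately show ?thesis using N_comm[OF xy] by simp
  qed
  with comm_N G show ?thesis by (simp add: metabelian_def)
qed

lemma U_metabelian: "G \<in> U \<Longrightarrow> metabelian G"
proof -
  have "\<Union> {pv_prod (Ab p) (Ab (p - 1)) | p. prime p} \<subseteq> {G. metabelian G \<and> finite (carrier G)}"
    using metabelian_pv_prod_Ab by (auto simp: pv_prod_def)
  then have "U \<subseteq> {G. metabelian G \<and> finite (carrier G)}"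
    unfolding U_def pv_join_def using pseudovariety_metabelian by (intro Inter_lower) simp
  then show "G \<in> U \<Longrightarrow> metabelian G" by auto
qed

lemma pseudovariety_U: "pseudovariety U"
  unfolding U_def by (rule pseudovariety_pv_join) (auto simp: pv_prod_def finite_groups_def)

lemma parity_group_in_U: "parity_group \<in> U"
proof -
  have grp: "group parity_group"
    using comm_group_parity_group by (simp add: comm_group.axioms)
  interpret P: group parity_group by fact
  let ?N = "carrier parity_group"
  let ?T = "singleton_group (0 :: nat)"
  have normal: "?N \<lhd> parity_group" by (rule P.normal_invI) (auto intro: P.subgroup_self)
  have Ab2: "parity_group\<lparr>carrier := ?N\<rparr> \<in> Ab 2"
    using comm_group_parity_group
    by (auto simp: Ab_def parity_group_def numeral_2_eq_2 nat_pow_def)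
  have T: "?T \<in> Ab (2 - 1)"
    by (auto simp: Ab_def singleton_group_def intro!: comm_groupI)
  have Q: "group (parity_group Mod ?N)" by (rule normal.factorgroup_is_group[OF normal])
  have "carrier (parity_group Mod ?N) = {?N}"
    by (auto simp: FactGroup_def RCOSETS_def r_coset_def parity_group_def)
  then have "(\<lambda>_. 0) \<in> iso (parity_group Mod ?N) ?T"
    by (auto simp: iso_def hom_def bij_betw_def singleton_group_def)
  then have "belongs_to (parity_group Mod ?N) (Ab (2 - 1))"
    using T Q by (auto simp: belongs_to_def is_iso_def)
  then have "parity_group \<in> pv_prod (Ab 2) (Ab (2 - 1))"
    using normal Ab2 grp by (auto simp: pv_prod_def) (auto simp: parity_group_def)
  then show ?thesis
    unfolding U_def pv_join_def using two_is_prime_nat by blast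
qed

section \<open>Finitely generated subgroups of a free group of infinite rank\<close>

text \<open>The subbasic open sets are preimages under homomorphisms, so none of them separates points
  that all these homomorphisms identify; unions and finite intersections do not either.\<close>

lemma openin_pro_topology_indistinguishable:
  assumes "openin (pro_topology V G) A" "x \<in> carrier G" "y \<in> carrier G"
    and "\<And>K h. K \<in> V \<Longrightarrow> h \<in> hom G K \<Longrightarrow> h x = h y"
  shows "x \<in> A \<longleftrightarrow> y \<in> A"
proof -
  have "generate_topology_on {h -` A \<inter> carrier G | h A K. K \<in> V \<and> h \<in> hom G K \<and> A \<subseteq> carrier K} A"
    using assms(1) by (simp add: pro_topology_def openin_topology_generated_by_iff)
  then show ?thesis
  proof induction
    case (Basis s)
    then obtain h A K where "s = h -` A \<inter> carrier G" "K \<in> V" "h \<in> hom G K"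
      by blast
    then show ?case using assms(2,3) assms(4)[of K h] by simp
  qed auto
qed

lemma openin_pro_topology_vimage:
  "K \<in> V \<Longrightarrow> h \<in> hom G K \<Longrightarrow> A \<subseteq> carrier K \<Longrightarrow> openin (pro_topology V G) (h -` A \<inter> carrier G)"
  unfolding pro_topology_def by (rule topology_generated_by_Basis) blast

definition commutator_word ::
    "(bool \<times> 'a) list \<Rightarrow> (bool \<times> 'a) list \<Rightarrow> (bool \<times> 'a) list"
  where "commutator_word v w =
    v @ w @ map inverse_letter (rev v) @ map inverse_letter (rev w)"

lemma set_commutator_word:
  "set v \<subseteq> UNIV \<times> X \<Longrightarrow> set w \<subseteq> UNIV \<times> X \<Longrightarrow> set (commutator_word v w) \<subseteq> UNIV \<times> X"
  by (auto simp: commutator_word_def inverse_letter_def)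

lemma (in group) eval_commutator_word:
  assumes v: "set v \<subseteq> UNIV \<times> carrier G" and w: "set w \<subseteq> UNIV \<times> carrier G"
  shows "eval_word G (commutator_word v w) = commutator G (eval_word G v) (eval_word G w)"
proof -
  have inverse: "set (map inverse_letter (rev u)) \<subseteq> UNIV \<times> carrier G"
    if "set u \<subseteq> UNIV \<times> carrier G" for u
    using that by (auto simp: inverse_letter_def)
  let ?v' = "map inverse_letter (rev v)" and ?w' = "map inverse_letter (rev w)"
  have "eval_word G (v @ w @ ?v' @ ?w') =
      eval_word G v \<otimes> (eval_word G w \<otimes> (eval_word G ?v' \<otimes> eval_word G ?w'))"
    using v w inverse[OF v] inverse[OF w]
    by (simp only: eval_word_append set_append Un_subset_iff simp_thms)
  also have "\<dots> = commutator G (eval_word G v) (eval_word G w)"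
    using eval_word_closed[OF v] eval_word_closed[OF w]
    by (simp add: eval_inverse_word[OF v] eval_inverse_word[OF w] commutator_def m_assoc)
  finally show ?thesis by (simp only: commutator_word_def)
qed

theorem proposition7p10:
  fixes F :: "('a, 'b) monoid_scheme" and H :: "'a set"
  assumes "free_group_of_infinite_rank F"
    and "fg_subgroup H F"
  shows "\<not> closedin (pro_topology U F) H \<and>
         pro_topology U F closure_of H \<noteq> topspace (pro_topology U F)"
proof -
  obtain X where F: "group F" and X: "infinite X" "free_basis F X"
    using assms(1) by (auto simp: free_group_of_infinite_rank_def)
  interpret group F by fact
  have XF: "X \<subseteq> carrier F" using X(2) by (simp add: free_basis_def)
  obtain Y where Y: "finite Y" "\<And>g. g \<in> H \<Longrightarrow> set (normal_form F X g) \<subseteq> UNIV \<times> Y"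
    using fg_subgroup_finite_support[OF F X(2) assms(2)] by blast
  have H: "subgroup H F" using assms(2) by (simp add: fg_subgroup_def)
  have space: "topspace (pro_topology U F) = carrier F"
    by (rule topspace_pro_topology[OF pseudovariety_U F])
  have fresh: "\<exists>x. x \<in> X \<and> x \<notin> Z" if "finite Z" for Z
    using X(1) that by (meson finite_subset subsetI)
  obtain a where a: "a \<in> X" "a \<notin> Y" using fresh[of Y] Y(1) by auto
  obtain b where b: "b \<in> X" "b \<noteq> a" using fresh[of "{a}"] by auto
  obtain c where c: "c \<in> X" "c \<noteq> a" "c \<noteq> b" using fresh[of "{a, b}"] by auto
  obtain d where d: "d \<in> X" "d \<noteq> a" "d \<noteq> b" "d \<noteq> c" using fresh[of "{a, b, c}"] by auto
  have "\<not> closedin (pro_topology U F) H"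
  proof
    assume "closedin (pro_topology U F) H"
    then have op: "openin (pro_topology U F) (carrier F - H)"
      by (simp add: closedin_def space)
    define u v where "u = commutator_word [(True, a)] [(True, b)]"
      and "v = commutator_word [(True, c)] [(True, d)]"
    define w where "w = commutator_word u v"
    have abcd: "{a, b, c, d} \<subseteq> carrier F" using a b c d XF by auto
    have spelled: "w =
      [(True, a), (True, b), (False, a), (False, b), (True, c), (True, d), (False, c), (False, d),
       (True, b), (True, a), (False, b), (False, a), (True, d), (True, c), (False, d), (False, c)]"
      by (simp add: w_def u_def v_def commutator_word_def inverse_letter_def)
    \<comment> \<open>No cancellation: adjacent letters belong to different generators.\<close>
    have red: "w \<in> reduced_words X"
      using a(1) b c d unfolding spelled reduced_words_def by simp
    have "(True, a) \<in> set w" by (simp add: spelled)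
    then have notin: "eval_word F w \<notin> H"
      using Y(2)[of "eval_word F w"] a(2) by (auto simp: normal_form_eval[OF X(2) red])
    have ev: "eval_word F w = commutator F (commutator F a b) (commutator F c d)"
    proof -
      have letter: "set [(True, x)] \<subseteq> UNIV \<times> carrier F" "eval_word F [(True, x)] = x"
        if "x \<in> {a, b, c, d}" for x
        using that abcd by (auto simp: eval_letter_def)
      have "set u \<subseteq> UNIV \<times> carrier F" "set v \<subseteq> UNIV \<times> carrier F"
        unfolding u_def v_def by (intro set_commutator_word letter(1); simp)+
      then have "eval_word F w = commutator F (eval_word F u) (eval_word F v)"
        unfolding w_def by (rule eval_commutator_word)
      also have "eval_word F u = commutator F a b"
        unfolding u_def by (subst eval_commutator_word)
          (use letter in \<open>simp_all only: insert_iff simp_thms\<close>)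
      also have "eval_word F v = commutator F c d"
        unfolding v_def by (subst eval_commutator_word)
          (use letter in \<open>simp_all only: insert_iff simp_thms\<close>)
      finally show ?thesis .
    qed
    have closed: "eval_word F w \<in> carrier F"
      using abcd unfolding ev by (simp add: commutator_closed)
    have "h (eval_word F w) = h \<one>\<^bsub>F\<^esub>" if K: "K \<in> U" "h \<in> hom F K" for K h
    proof -
      have mK: "metabelian K" using U_metabelian K(1) .
      then have gK: "group K" by (rule metabelian_imp_group)
      note h_comm = hom_commutator[OF F gK K(2)]
      have carr: "a \<in> carrier F" "b \<in> carrier F" "c \<in> carrier F" "d \<in> carrier F"
        using abcd by auto
      have "h (eval_word F w) = commutator K (commutator K (h a) (h b)) (commutator K (h c) (h d))"
        using carr by (simp only: ev h_comm commutator_closed)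
      also have "\<dots> = \<one>\<^bsub>K\<^esub>"
        using mK carr hom_in_carrier[OF K(2)] unfolding metabelian_def by blast
      finally have "h (eval_word F w) = \<one>\<^bsub>K\<^esub>" .
      then show ?thesis using hom_one[OF K(2) F gK] by simp
    qed
    then have "eval_word F w \<in> carrier F - H \<longleftrightarrow> \<one>\<^bsub>F\<^esub> \<in> carrier F - H"
      by (intro openin_pro_topology_indistinguishable[OF op closed one_closed])
    then show False using closed notin subgroup.one_closed[OF H] by simp
  qed
  moreover have "a \<notin> pro_topology U F closure_of H"
  proof -
    define h where "h g = count_list (map snd (normal_form F X g)) a mod 2" for g
    have "h \<in> hom F parity_group"
      using letter_parity_hom[OF F X(2), of a] by (simp add: h_def[abs_def])
    then have op: "openin (pro_topology U F) (h -` {1} \<inter> carrier F)"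
      using parity_group_in_U by (intro openin_pro_topology_vimage) (auto simp: parity_group_def)
    have even_H: "h g = 0" if "g \<in> H" for g
    proof -
      have "a \<notin> set (map snd (normal_form F X g))"
        using Y(2)[OF that] a(2) by auto
      then show ?thesis by (simp add: h_def count_list_0_iff)
    qed
    have "[(True, a)] \<in> reduced_words X" using a by (simp add: reduced_words_def)
    from normal_form_eval[OF X(2) this] have "normal_form F X a = [(True, a)]"
      using a(1) XF by (simp add: eval_letter_def subset_iff)
    then have odd_a: "a \<in> h -` {1} \<inter> carrier F" using a(1) XF by (auto simp: h_def)
    show ?thesis
    proof
      assume "a \<in> pro_topology U F closure_of H"
      then have "\<exists>g. g \<in> H \<and> g \<in> h -` {1} \<inter> carrier F"
        unfolding in_closure_of using op odd_a by meson
      then show False using even_H by force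
    qed
  qed
  ultimately show ?thesis using space a XF by auto
qed

end
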